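(* For all integers $k\geq1$, \[ (1-tq)\, T_k(tq,q) = T_k(t,q) + t^2 q^{2k+1}\, T_{k-1}(t,q). \]
   Context: The polynomials $T_k(t,q)$ in the indeterminates $t,q$ are defined by $T_0(t,q)=1$ and, for $k\ge1$, \[ T_k(t,q) = T_{k-1}(t,q) + (1+t)(-q)^{k^2} + (1-t^2) \sum_{i=1}^{k-1} (-q)^{k^2-i^2}\, T_{i-1}(t,q). \] $T_k(tq,q)$ denotes the result of substituting $tq$ for $t$. *)

theory Defs
  imports "HOL-Computational_Algebra.Polynomial"
begin

text \<open>Polynomials in the indeterminates $t, q$ over the integers are elements of
  $(\mathbf{Z}[q])[t]$: the outer indeterminate is $t$, and the coefficient
  ring is $\mathbf{Z}[q]$.\<close>

definition var_t :: "int poly poly" where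
  "var_t = [:0, 1:]"

definition var_q :: "int poly poly" where
  "var_q = [:[:0, 1:]:]"

text \<open>The recurrence is stated at index $k + 1$, so the summation range $1 \le i \le (k+1) - 1$
  is \<open>{1..k}\<close>; on it the natural-number subtractions do not truncate.\<close>

fun T :: "nat \<Rightarrow> int poly poly" where
  "T 0 = 1"
| "T (Suc k) = T k + (1 + var_t) * (- var_q) ^ ((Suc k)\<^sup>2)
     + (1 - var_t\<^sup>2) * (\<Sum>i\<in>{1..k}. (- var_q) ^ ((Suc k)\<^sup>2 - i\<^sup>2) * T (i - 1))"

text \<open>Substitution of $s$ for the outer indeterminate $t$, leaving $q$ unchanged.\<close>

abbreviation subst_t :: "int poly poly \<Rightarrow> int poly poly \<Rightarrow> int poly poly" where
  "subst_t p s \<equiv> pcompose p s"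

end

theory Submission
  imports Defs
begin

text \<open>Comparing the recurrences for \<open>T (k + 2)\<close> and \<open>T (k + 1)\<close> eliminates the sum and leaves
  a three-term recurrence, which turns the right-hand side of the theorem into
  \<open>R k = T (k + 1) + q ^ (2 * k + 1) * T k\<close>. The sequences \<open>R k\<close> and
  \<open>(1 - t * q) * T k\<close> at \<open>t * q\<close> satisfy the same three-term recurrence
  and have the same initial values.\<close>

text \<open>Since \<open>(k + 2)^2 = (2 * k + 3) + (k + 1)^2\<close>, every old term is multiplied
  by the same factor \<open>Q\<close>, and only the summand \<open>i = k + 1\<close> is new. The odd
  exponent makes \<open>Q\<close> negative.\<close>

lemma T_three_term:
  "T (Suc (Suc k)) = (1 - var_q ^ (2 * k + 3)) * T (Suc k) + var_t\<^sup>2 * var_q ^ (2 * k + 3) * T k"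
proof -
  define Q where "Q = (- var_q) ^ (2 * k + 3)"
  define S where "S = (\<Sum>i\<in>{1..k}. (- var_q) ^ ((Suc k)\<^sup>2 - i\<^sup>2) * T (i - 1))"
  have Q: "Q = - (var_q ^ (2 * k + 3))"
    unfolding Q_def by (rule power_minus_odd) simp
  have sq: "(Suc (Suc k))\<^sup>2 = 2 * k + 3 + (Suc k)\<^sup>2"
    by (simp add: power2_eq_square)
  have "(- var_q) ^ ((Suc (Suc k))\<^sup>2 - i\<^sup>2) * T (i - 1)
      = Q * ((- var_q) ^ ((Suc k)\<^sup>2 - i\<^sup>2) * T (i - 1))" if "i \<in> {1..k}" for i
  proof -
    have "i\<^sup>2 \<le> (Suc k)\<^sup>2" using that by (intro power_mono) auto
    then have "(Suc (Suc k))\<^sup>2 - i\<^sup>2 = 2 * k + 3 + ((Suc k)\<^sup>2 - i\<^sup>2)"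
      unfolding sq by linarith
    then show ?thesis by (simp only: Q_def power_add mult.assoc)
  qed
  then have "(\<Sum>i\<in>{1..k}. (- var_q) ^ ((Suc (Suc k))\<^sup>2 - i\<^sup>2) * T (i - 1)) = Q * S"
    unfolding S_def sum_distrib_left by (intro sum.cong refl)
  moreover have "(- var_q) ^ ((Suc (Suc k))\<^sup>2 - (Suc k)\<^sup>2) = Q"
    unfolding sq Q_def by simp
  ultimately have sum: "(\<Sum>i\<in>{1..Suc k}. (- var_q) ^ ((Suc (Suc k))\<^sup>2 - i\<^sup>2) * T (i - 1))
      = Q * S + Q * T k"
    by simp
  have D: "(1 + var_t) * (- var_q) ^ ((Suc k)\<^sup>2) + (1 - var_t\<^sup>2) * S = T (Suc k) - T k"
    unfolding S_def T.simps(2)[of k] by (simp only: algebra_simps)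
  have "T (Suc (Suc k)) = T (Suc k)
      + Q * ((1 + var_t) * (- var_q) ^ ((Suc k)\<^sup>2) + (1 - var_t\<^sup>2) * S) + (1 - var_t\<^sup>2) * Q * T k"
    unfolding T.simps(2)[of "Suc k"] sum by (simp only: sq power_add Q_def algebra_simps)
  \<comment> \<open>By \<open>D\<close> the bracket is \<open>T (Suc k) - T k\<close>, so
    \<open>T k\<close> gets the coefficient \<open>- Q + (1 - t^2) * Q = - t^2 * Q\<close>.\<close>
  then have "T (Suc (Suc k)) = (1 + Q) * T (Suc k) - var_t\<^sup>2 * Q * T k"
    unfolding D by (simp add: algebra_simps del: T.simps(2))
  then show ?thesis unfolding Q by simp
qed

lemma T_1: "T (Suc 0) = 1 - var_q - var_t * var_q"
  by (simp add: algebra_simps)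

lemma pcompose_power: "pcompose (p ^ n) s = pcompose p s ^ n"
  for p s :: "'a::comm_semiring_1 poly"
  by (induction n) (simp_all add: pcompose_mult pcompose_1)

lemma subst_t_var_t [simp]: "subst_t var_t s = s"
  by (simp add: var_t_def pcompose_pCons)

lemma subst_t_var_q [simp]: "subst_t var_q s = var_q"
  by (simp add: var_q_def)

text \<open>With \<open>T (Suc k)\<close> in place of \<open>T (k - 1)\<close> the identity holds at
  \<open>k = 0\<close> too, where the induction starts.\<close>

lemma subst_t_T_eq:
  "(1 - var_t * var_q) * subst_t (T k) (var_t * var_q) = T (Suc k) + var_q ^ (2 * k + 1) * T k"
proof (induction k rule: induct_nat_012)
  case 0
  show ?case by (simp add: T_1 pcompose_1 del: T.simps(2))
next
  case 1
  show ?case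
    unfolding T_three_term T_1
    by (simp add: pcompose_add pcompose_diff pcompose_mult pcompose_1 algebra_simps power2_eq_square eval_nat_numeral)
next
  case (ge2 k)
  let ?U = "\<lambda>k. subst_t (T k) (var_t * var_q)"
  \<comment> \<open>Writing every power of q as a fixed power times \<open>Q\<close> removes
    \<open>k\<close> from the exponents, as \<open>algebra\<close> requires.\<close>
  define Q where "Q = var_q ^ (2 * k + 1)"
  have pow: "var_q ^ (2 * k + 3) = var_q\<^sup>2 * Q" "var_q ^ (2 * Suc k + 1) = var_q\<^sup>2 * Q"
    "var_q ^ (2 * Suc k + 3) = var_q\<^sup>2 * (var_q\<^sup>2 * Q)"
    "var_q ^ (2 * Suc (Suc k) + 1) = var_q\<^sup>2 * (var_q\<^sup>2 * Q)"
    unfolding Q_def by (simp_all add: power2_eq_square eval_nat_numeral)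
  \<comment> \<open>The substitution alters only the coefficient \<open>t^2\<close>.\<close>
  have U: "?U (Suc (Suc k)) = (1 - var_q\<^sup>2 * Q) * ?U (Suc k)
      + (var_t * var_q)\<^sup>2 * (var_q\<^sup>2 * Q) * ?U k"
    unfolding T_three_term
    by (simp only: pcompose_add pcompose_diff pcompose_mult pcompose_power pcompose_1
        subst_t_var_t subst_t_var_q flip: pow(1))
  note IH = ge2[unfolded pow, folded Q_def]
  note T3 = T_three_term[of "Suc k", unfolded pow] T_three_term[of k, unfolded pow]
  show ?case
    unfolding pow U using IH T3 by algebra
qed

theorem corollary4p2:
  fixes k :: nat
  assumes "k \<ge> 1"
  shows "(1 - var_t * var_q) * subst_t (T k) (var_t * var_q)
           = T k + var_t\<^sup>2 * var_q ^ (2 * k + 1) * T (k - 1)"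
proof -
  from assms obtain j where k: "k = Suc j" by (cases k) auto
  define P where "P = var_q ^ (2 * k + 1)"
  \<comment> \<open>At \<open>j = k - 1\<close> the three-term recurrence has coefficient
    \<open>P\<close>, so \<open>P * T k\<close> cancels.\<close>
  have "2 * j + 3 = 2 * k + 1" using k by simp
  then have "T (Suc k) = (1 - P) * T k + var_t\<^sup>2 * P * T j"
    using T_three_term[of j] k unfolding P_def by (simp only:)
  then have "T (Suc k) + P * T k = T k + var_t\<^sup>2 * P * T (k - 1)"
    by (simp add: k algebra_simps del: T.simps(2))
  then show ?thesis
    unfolding subst_t_T_eq P_def .
qed

end
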